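(* Let $b>0$ and let $m$ and $n$ be two self-connected nodes of a KD-tree on a finite data set $\{0,\dots,N-1\}$ with distance function $\mathrm{Dist}$, with point sets $P[m]$ and $P[n]$. Let $H[0:N]$ be a parent array (forest) on the data set in which the points of each of these nodes already form part of a single proto-feature, i.e. $\mathrm{root}(u)=\mathrm{root}(u')$ for all $u,u'\in P[m]$ and $\mathrm{root}(v)=\mathrm{root}(v')$ for all $v,v'\in P[n]$. Then merging a single neighboring pair from $m$ and $n$ is equivalent to visiting and merging all neighboring pairs: for every neighboring pair $(u,v)$, i.e. $u\in P[m]$, $v\in P[n]$ with $\mathrm{Dist}(u,v)<b$, the partition of the data set into proto-features after performing the single operation $\mathrm{merge}(H,u,v)$ is the same as the partition into proto-features obtained from the same initial $H$ by performing $\mathrm{merge}(H,u',v')$ successively, in any order, for all neighboring pairs $(u',v')\in P[m]\times P[n]$ with $\mathrm{Dist}(u',v')<b$.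
   Context: Setting. The data set consists of $N$ points indexed by $0,\dots,N-1$, with a distance function (metric) $\mathrm{Dist}(i,j)$; $b>0$ is the linking length. A KD-tree on the data set is a binary tree each of whose nodes $m$ has an associated nonempty list $P[m]$ of the data points it contains. Self-connected node. For nodes $m,n$, $\mathrm{MaxDist}(m,n)$ is the maximum of $\mathrm{Dist}(i,j)$ over $i\in P[m]$, $j\in P[n]$. A node $m$ is self-connected if $\mathrm{MaxDist}(m,m)<b$, so that any two points of $P[m]$ are at distance less than $b$. Forest of proto-features. An array $H[0:N]$ with values in $\{0,\dots,N-1\}$ represents a forest: $H[i]=p$ means $p$ is the parent of $i$, and $r$ is a root iff $H[r]=r$; following parents from any $i$ reaches, after finitely many steps, a root, denoted $\mathrm{root}(i)$. The proto-features are the classes of the equivalence relation $\mathrm{root}(i)=\mathrm{root}(j)$; the partition into proto-features is the partition into these classes. Operations. $\mathrm{splay}(H,i)$: compute $r=\mathrm{root}(i)$ by following parents, set $H[i]\leftarrow r$ (optionally also set $H[k]\leftarrow r$ for every $k$ on the path followed from $i$ to $r$), and return $r$. $\mathrm{merge}(H,i,j)$: set $r\leftarrow \mathrm{splay}(H,i)$, then $s\leftarrow\mathrm{splay}(H,j)$, then $H[r]\leftarrow s$. *)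

theory Defs
  imports "HOL-Analysis.Analysis" "HOL-Library.Tree"
begin

section \<open>KD-trees on the data set\<close>

text \<open>
  The data points are the indices \<open>0, \<dots>, N - 1\<close>. A node of a tree is represented by the non-leaf
  subtree rooted at it, so that its list of points is the label at the root of that subtree;
  \<^const>\<open>Leaf\<close> is the absence of a child and not a node.
\<close>

type_synonym kd_tree = "nat list tree"

definition kd_nodes :: "kd_tree \<Rightarrow> kd_tree set" where
  "kd_nodes T = subtrees T - {\<langle>\<rangle>}"

definition node_points :: "kd_tree \<Rightarrow> nat list" where
  "node_points m = value m"

definition is_kd_tree :: "nat \<Rightarrow> kd_tree \<Rightarrow> bool" where
  "is_kd_tree N T \<longleftrightarrow> (\<forall>m \<in> kd_nodes T. node_points m \<noteq> [] \<and> set (node_points m) \<subseteq> {..<N})"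

definition max_dist :: "(nat \<Rightarrow> nat \<Rightarrow> real) \<Rightarrow> kd_tree \<Rightarrow> kd_tree \<Rightarrow> real" where
  "max_dist Dist m n = Max {Dist i j | i j. i \<in> set (node_points m) \<and> j \<in> set (node_points n)}"

definition self_connected :: "(nat \<Rightarrow> nat \<Rightarrow> real) \<Rightarrow> real \<Rightarrow> kd_tree \<Rightarrow> bool" where
  "self_connected Dist b m \<longleftrightarrow> max_dist Dist m m < b"

definition neighboring_pairs ::
    "(nat \<Rightarrow> nat \<Rightarrow> real) \<Rightarrow> real \<Rightarrow> kd_tree \<Rightarrow> kd_tree \<Rightarrow> (nat \<times> nat) set" where
  "neighboring_pairs Dist b m n =
     {(u, v). u \<in> set (node_points m) \<and> v \<in> set (node_points n) \<and> Dist u v < b}"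

section \<open>Parent arrays and proto-features\<close>

definition is_root :: "nat list \<Rightarrow> nat \<Rightarrow> bool" where
  "is_root H r \<longleftrightarrow> r < length H \<and> H ! r = r"

text \<open>
  All indices visited when following parents from \<open>i\<close>, including \<open>i\<close> itself. Since a root is its own
  parent, in a forest this is the path from \<open>i\<close> to its root, both ends included.
\<close>

definition parent_path :: "nat list \<Rightarrow> nat \<Rightarrow> nat set" where
  "parent_path H i = range (\<lambda>k. ((!) H ^^ k) i)"

definition is_parent_array :: "nat \<Rightarrow> nat list \<Rightarrow> bool" where
  "is_parent_array N H \<longleftrightarrow>
     length H = N \<and> set H \<subseteq> {..<N} \<and> (\<forall>i<N. \<exists>r \<in> parent_path H i. is_root H r)"

definition root_of :: "nat list \<Rightarrow> nat \<Rightarrow> nat" where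
  "root_of H i = (THE r. r \<in> parent_path H i \<and> is_root H r)"

definition proto_features :: "nat list \<Rightarrow> nat set set" where
  "proto_features H =
     {..<length H} // {(i, j). i < length H \<and> j < length H \<and> root_of H i = root_of H j}"

section \<open>Operations\<close>

text \<open>
  The Boolean \<open>c\<close> says whether the optional path compression is carried out. It is an argument of
  every single call, so the choice may differ from call to call.
\<close>

definition splay :: "bool \<Rightarrow> nat list \<Rightarrow> nat \<Rightarrow> nat list \<times> nat" where
  "splay c H i =
     (let r = root_of H i;
          H' = H[i := r]
      in (if c then map (\<lambda>k. if k \<in> parent_path H i then r else H' ! k) [0..<length H] else H', r))"

definition merge_roots :: "bool \<times> bool \<Rightarrow> nat list \<Rightarrow> nat \<Rightarrow> nat \<Rightarrow> nat list" where
  "merge_roots cs H i j =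
     (let (H1, r) = splay (fst cs) H i;
          (H2, s) = splay (snd cs) H1 j
      in H2[r := s])"

text \<open>Each operation is a pair of points together with the compression choices of its two splays.\<close>

definition merge_all :: "((nat \<times> nat) \<times> (bool \<times> bool)) list \<Rightarrow> nat list \<Rightarrow> nat list" where
  "merge_all ops H = fold (\<lambda>((i, j), cs) H'. merge_roots cs H' i j) ops H"

end

theory Submission
  imports Defs
begin

text \<open>
  If \<open>R\<close> and \<open>S\<close> are the roots of the points of \<open>m\<close> and of \<open>n\<close>, then merging any one pair from
  \<open>P[m] \<times> P[n]\<close> replaces the root \<open>R\<close> by \<open>S\<close> everywhere and changes no other root, whichever path
  compressions are carried out. After the first merge all these points have the root \<open>S\<close>, so every
  further merge joins two points with a common root and leaves all roots unchanged.
\<close>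

section \<open>Following parents to a root\<close>

text \<open>A derivation is a finite walk from an index to its root, so \<open>rooted.induct\<close>
  is induction along that walk; the definite description \<open>root_of\<close> offers no such
  principle.\<close>

inductive rooted :: "nat list \<Rightarrow> nat \<Rightarrow> nat \<Rightarrow> bool" for H where
  root: "is_root H r \<Longrightarrow> rooted H r r"
| step: "i < length H \<Longrightarrow> rooted H (H ! i) r \<Longrightarrow> rooted H i r"

lemma rooted_imp_is_root: "rooted H i r \<Longrightarrow> is_root H r"
  by (induction rule: rooted.induct)

lemma rooted_imp_less_length: "rooted H i r \<Longrightarrow> i < length H"
  by (auto elim: rooted.cases simp: is_root_def)

lemma rooted_from_root: "rooted H i r \<Longrightarrow> H ! i = i \<Longrightarrow> r = i"
  by (induction rule: rooted.induct) auto

lemma rooted_nth: "rooted H i r \<Longrightarrow> rooted H (H ! i) r"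
  by (erule rooted.cases) (auto simp: is_root_def intro: rooted.root)

text \<open>Following parents is deterministic, and the two rules overlap only at a root, where a
  step stays in place.\<close>

lemma rooted_unique: "rooted H i r \<Longrightarrow> rooted H i r' \<Longrightarrow> r = r'"
proof (induction rule: rooted.induct)
  case (root r)
  then show ?case using rooted_from_root is_root_def by metis
qed (blast dest: rooted_nth)

lemma rooted_imp_parent_path: "rooted H i r \<Longrightarrow> r \<in> parent_path H i"
proof (induction rule: rooted.induct)
  case (root r)
  show ?case unfolding parent_path_def by (rule range_eqI[of _ _ 0]) simp
next
  case (step i r)
  then obtain k where "r = ((!) H ^^ k) (H ! i)" by (auto simp: parent_path_def)
  then show ?case
    unfolding parent_path_def by (intro range_eqI[of _ _ "Suc k"]) (simp add: funpow_swap1)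
qed

text \<open>The bound on the entries keeps every iterate inside the array, as
  \<open>rooted.step\<close> demands.\<close>

lemma parent_path_imp_rooted:
  assumes "set H \<subseteq> {..<length H}" "i < length H" "r \<in> parent_path H i" "is_root H r"
  shows "rooted H i r"
proof -
  have "rooted H i (((!) H ^^ k) i)" if "is_root H (((!) H ^^ k) i)" "i < length H" for k
    using that
  proof (induction k arbitrary: i)
    case 0
    then show ?case by (auto intro: rooted.root)
  next
    case (Suc k)
    then have "H ! i < length H" using assms(1) nth_mem by blast
    then show ?case using Suc by (auto simp: funpow_swap1 intro: rooted.step)
  qed
  then show ?thesis using assms by (auto simp: parent_path_def)
qed

text \<open>The range condition is implicit on the right: \<open>rooted\<close> passes to the parent
  and holds only of indices inside the array. Invariance under an operation thus reduces to
  transferring \<open>rooted\<close>.\<close>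

lemma is_parent_array_iff_rooted:
  "is_parent_array N H \<longleftrightarrow> length H = N \<and> (\<forall>i<N. \<exists>r. rooted H i r)"
proof
  assume "is_parent_array N H"
  then show "length H = N \<and> (\<forall>i<N. \<exists>r. rooted H i r)"
    unfolding is_parent_array_def by (metis parent_path_imp_rooted)
next
  assume *: "length H = N \<and> (\<forall>i<N. \<exists>r. rooted H i r)"
  then have "H ! i < N" if "i < N" for i
    using that rooted_nth rooted_imp_less_length by blast
  then have "set H \<subseteq> {..<N}" using * by (auto simp: in_set_conv_nth)
  then show "is_parent_array N H"
    unfolding is_parent_array_def using * rooted_imp_parent_path rooted_imp_is_root by blast
qed

lemma rooted_iff_root_of:
  assumes "is_parent_array N H" "i < N"
  shows "rooted H i r \<longleftrightarrow> root_of H i = r"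
proof -
  have set: "set H \<subseteq> {..<length H}" "i < length H"
    using assms by (auto simp: is_parent_array_def)
  obtain s where s: "rooted H i s" using assms is_parent_array_iff_rooted by blast
  have "root_of H i = s" unfolding root_of_def
    using s set by (blast intro: rooted_imp_parent_path rooted_imp_is_root
        dest: parent_path_imp_rooted rooted_unique)
  then show ?thesis using s rooted_unique by blast
qed

lemma parent_path_root_of:
  assumes "is_parent_array N H" "i < N" "k \<in> parent_path H i"
  shows "rooted H k (root_of H i)"
proof -
  have "rooted H (((!) H ^^ l) i) (root_of H i)" for l
  proof (induction l)
    case 0
    then show ?case using assms rooted_iff_root_of by simp
  qed (simp add: rooted_nth)
  then show ?thesis using assms(3) by (auto simp: parent_path_def)
qed

section \<open>Splaying preserves roots\<close>

text \<open>Redirecting entries to their own roots only shortens walks, and roots stay fixed because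
  each is its own root. Allowing any set of redirected entries covers splaying with and without
  compression.\<close>

lemma rooted_shortcut:
  assumes "rooted H i r" and len: "length H' = length H"
    and "\<And>k. k < length H \<Longrightarrow> H' ! k = H ! k \<or> rooted H k (H' ! k)"
  shows "rooted H' i r"
proof -
  have is_root': "is_root H' t" if "is_root H t" for t
    using that assms(3)[of t] len rooted_from_root[of H t] by (auto simp: is_root_def)
  from assms(1) show ?thesis
  proof (induction rule: rooted.induct)
    case (root r)
    then show ?case using is_root' rooted.root by blast
  next
    case (step i r)
    then consider "H' ! i = H ! i" | "rooted H i (H' ! i)" using assms(3) by blast
    then show ?case
    proof cases
      case 1
      then show ?thesis using step len by (simp add: rooted.step)
    next
      case 2
      moreover have "rooted H i r" using step by (simp add: rooted.step)
      ultimately have "H' ! i = r" using rooted_unique by blast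
      moreover have "rooted H' r r"
        using step is_root' rooted_imp_is_root rooted.root by blast
      ultimately show ?thesis using step len by (simp add: rooted.step)
    qed
  qed
qed

lemma splay_correct:
  assumes "is_parent_array N H" "i < N"
  obtains H' where "splay c H i = (H', root_of H i)" "is_parent_array N H'"
    "\<And>k. k < N \<Longrightarrow> root_of H' k = root_of H k"
proof -
  define H' where "H' = fst (splay c H i)"
  have len: "length H' = length H"
    by (simp add: H'_def splay_def Let_def)
  \<comment> \<open>Every rewritten entry receives \<open>root_of H i\<close>. This is the root of
    the index written to, since all of \<open>parent_path H i\<close> shares one root.\<close>
  have "H' ! k = H ! k \<or> rooted H k (H' ! k)" if "k < length H" for k
    using that assms parent_path_root_of[OF assms] rooted_iff_root_of[OF assms]
    by (auto simp: H'_def splay_def Let_def nth_list_update is_parent_array_def)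
  then have rooted: "rooted H k r \<Longrightarrow> rooted H' k r" for k r
    using rooted_shortcut len by blast
  then have parent: "is_parent_array N H'"
    using assms(1) len unfolding is_parent_array_iff_rooted by metis
  show thesis
  proof
    show "splay c H i = (H', root_of H i)" by (simp add: H'_def splay_def Let_def)
    show "root_of H' k = root_of H k" if "k < N" for k
      using that rooted rooted_iff_root_of[OF parent] rooted_iff_root_of[OF assms(1)] by blast
  qed (fact parent)
qed

section \<open>Merging two roots\<close>

text \<open>The old walk is unchanged until it meets \<open>r\<close>, from where one further step
  leads to \<open>s\<close>. The case \<open>r = s\<close> is included.\<close>

lemma rooted_link:
  assumes "rooted H i t" "is_root H r" "is_root H s"
  shows "rooted (H[r := s]) i (if t = r then s else t)"
proof -
  have s: "rooted (H[r := s]) s s"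
    using assms(2,3) by (auto intro!: rooted.root simp: is_root_def nth_list_update)
  have r: "rooted (H[r := s]) r s"
    using assms(2) s by (auto intro!: rooted.step[of r] simp: is_root_def)
  from assms(1) show ?thesis
  proof (induction rule: rooted.induct)
    case (root t)
    then show ?case using r
      by (auto intro!: rooted.root simp: is_root_def)
  next
    case (step i t)
    \<comment> \<open>The step rule also applies at a root, so the overwritten index
      \<open>r\<close> may occur here as \<open>i\<close>.\<close>
    show ?case
    proof (cases "i = r")
      case True
      then have "t = r" using step assms(2) rooted_from_root by (auto simp: is_root_def)
      then show ?thesis using r True by simp
    next
      case False
      then show ?thesis using step by (auto intro!: rooted.step[of i])
    qed
  qed
qed

text \<open>Both splays preserve all roots, so the second one, although run on the modified array,
  still returns the root of \<open>j\<close> in \<open>H\<close>, and the final assignment links two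
  genuine roots.\<close>

lemma merge_roots_correct:
  assumes "is_parent_array N H" "i < N" "j < N"
  shows "is_parent_array N (merge_roots cs H i j)"
    and "k < N \<Longrightarrow> root_of (merge_roots cs H i j) k =
      (if root_of H k = root_of H i then root_of H j else root_of H k)"
proof -
  obtain H1 where H1: "splay (fst cs) H i = (H1, root_of H i)" "is_parent_array N H1"
    "\<And>k. k < N \<Longrightarrow> root_of H1 k = root_of H k"
    using splay_correct[OF assms(1,2)] by blast
  obtain H2 where H2: "splay (snd cs) H1 j = (H2, root_of H1 j)" "is_parent_array N H2"
    "\<And>k. k < N \<Longrightarrow> root_of H2 k = root_of H1 k"
    using splay_correct[OF H1(2) assms(3)] by blast
  let ?H = "H2[root_of H i := root_of H j]"
  have merge: "merge_roots cs H i j = ?H"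
    using H1 H2 assms by (simp add: merge_roots_def)
  have rooted2: "rooted H2 k (root_of H k)" if "k < N" for k
    using that H1 H2 rooted_iff_root_of[OF H2(2)] by simp
  have "is_root H2 (root_of H i)" "is_root H2 (root_of H j)"
    using rooted2 assms rooted_imp_is_root by blast+
  then have rooted:
    "rooted ?H k (if root_of H k = root_of H i then root_of H j else root_of H k)" if "k < N" for k
    using rooted_link rooted2 that by blast
  then show parent: "is_parent_array N (merge_roots cs H i j)"
    using H2(2) unfolding merge is_parent_array_iff_rooted by auto
  show "k < N \<Longrightarrow> root_of (merge_roots cs H i j) k =
      (if root_of H k = root_of H i then root_of H j else root_of H k)"
    using rooted rooted_iff_root_of[OF parent] unfolding merge by blast
qed

text \<open>A merge of points with equal roots replaces a root by itself. Hence the assumption,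
  stated for the initial array, carries over to the array on which the remaining merges act.\<close>

lemma merge_all_common_root:
  assumes "is_parent_array N H"
    and "\<And>i j. (i, j) \<in> set (map fst ops) \<Longrightarrow> i < N \<and> j < N \<and> root_of H i = root_of H j"
  shows "is_parent_array N (merge_all ops H) \<and> (\<forall>k<N. root_of (merge_all ops H) k = root_of H k)"
  using assms
proof (induction ops arbitrary: H)
  case Nil
  then show ?case by (simp add: merge_all_def)
next
  case (Cons op ops)
  obtain i j cs where op: "op = ((i, j), cs)" by (metis surj_pair)
  let ?H = "merge_roots cs H i j"
  have ij: "i < N" "j < N" "root_of H i = root_of H j" using Cons.prems(2)[of i j] op by auto
  have parent: "is_parent_array N ?H" using merge_roots_correct(1) Cons.prems(1) ij by blast
  have roots: "root_of ?H k = root_of H k" if "k < N" for k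
    using merge_roots_correct(2)[OF Cons.prems(1) ij(1,2) that] ij(3) by simp
  have "i' < N \<and> j' < N \<and> root_of ?H i' = root_of ?H j'" if "(i', j') \<in> set (map fst ops)" for i' j'
    using Cons.prems(2)[of i' j'] that roots by auto
  from Cons.IH[OF parent this] show ?case
    using roots by (simp add: merge_all_def op)
qed

lemma proto_features_cong:
  assumes "length H = N" "length H' = N" "\<And>k. k < N \<Longrightarrow> root_of H k = root_of H' k"
  shows "proto_features H = proto_features H'"
proof -
  have "{(i, j). i < N \<and> j < N \<and> root_of H i = root_of H j} =
      {(i, j). i < N \<and> j < N \<and> root_of H' i = root_of H' j}"
    using assms(3) by auto
  then show ?thesis using assms(1,2) by (simp add: proto_features_def)
qed

section \<open>One merge against all merges\<close>

theorem theorem1: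
  fixes N :: nat and Dist :: "nat \<Rightarrow> nat \<Rightarrow> real" and b :: real
    and T m n :: kd_tree and H :: "nat list"
    and u v :: nat and cs :: "bool \<times> bool"
    and ops :: "((nat \<times> nat) \<times> (bool \<times> bool)) list"
  assumes "Metric_space {..<N} Dist"
    and "b > 0"
    and "is_kd_tree N T"
    and "m \<in> kd_nodes T" and "n \<in> kd_nodes T"
    and "self_connected Dist b m" and "self_connected Dist b n"
    and "is_parent_array N H"
    and "\<forall>x \<in> set (node_points m). \<forall>x' \<in> set (node_points m). root_of H x = root_of H x'"
    and "\<forall>y \<in> set (node_points n). \<forall>y' \<in> set (node_points n). root_of H y = root_of H y'"
    and "(u, v) \<in> neighboring_pairs Dist b m n"
    and "distinct (map fst ops)"
    and "set (map fst ops) = neighboring_pairs Dist b m n"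
  shows "proto_features (merge_roots cs H u v) = proto_features (merge_all ops H)"
proof -
  note parent = \<open>is_parent_array N H\<close>
  note m_root = assms(9) and n_root = assms(10)
  have pair: "i \<in> set (node_points m) \<and> j \<in> set (node_points n) \<and> i < N \<and> j < N"
    if "(i, j) \<in> neighboring_pairs Dist b m n" for i j
    using that \<open>is_kd_tree N T\<close> \<open>m \<in> kd_nodes T\<close> \<open>n \<in> kd_nodes T\<close>
    by (auto simp: neighboring_pairs_def is_kd_tree_def)
  note uv = pair[OF \<open>(u, v) \<in> neighboring_pairs Dist b m n\<close>]
  \<comment> \<open>The pair \<open>(u, v)\<close> occurs in the list, so there is a first merge; it
    may be of a different pair \<open>(u0, v0)\<close>.\<close>
  have "ops \<noteq> []" using assms(11,13) by auto
  then obtain u0 v0 cs0 ops' where ops: "ops = ((u0, v0), cs0) # ops'"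
    by (metis list.exhaust surj_pair)
  have "(u0, v0) \<in> neighboring_pairs Dist b m n" using assms(13) ops by auto
  note u0v0 = pair[OF this]
  let ?H0 = "merge_roots cs0 H u0 v0"
  have parent0: "is_parent_array N ?H0" using merge_roots_correct(1) parent u0v0 by blast
  \<comment> \<open>Constancy of the root on each node lets \<open>u\<close> and \<open>v\<close>
    stand for \<open>u0\<close> and \<open>v0\<close>, so the first merge has the same effect on
    roots as merging \<open>(u, v)\<close>.\<close>
  have roots0: "root_of ?H0 k =
      (if root_of H k = root_of H u then root_of H v else root_of H k)" if "k < N" for k
  proof -
    have "root_of H u0 = root_of H u" "root_of H v0 = root_of H v"
      using m_root n_root uv u0v0 by blast+
    then show ?thesis using merge_roots_correct(2) parent u0v0 that by simp
  qed
  have "i < N \<and> j < N \<and> root_of ?H0 i = root_of ?H0 j" if "(i, j) \<in> set (map fst ops')" for i j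
  proof -
    have "(i, j) \<in> neighboring_pairs Dist b m n" using that assms(13) ops by auto
    note ij = pair[OF this]
    then have "root_of H i = root_of H u" "root_of H j = root_of H v"
      using m_root n_root uv by blast+
    then show ?thesis using ij roots0 by simp
  qed
  from merge_all_common_root[OF parent0 this]
  have all: "is_parent_array N (merge_all ops H)"
    "\<And>k. k < N \<Longrightarrow> root_of (merge_all ops H) k = root_of ?H0 k"
    by (simp_all add: ops merge_all_def)
  \<comment> \<open>The two arrays agree in all roots, which is stronger than equality of the
    partitions; their entries may differ through the compression choices.\<close>
  show ?thesis
  proof (rule proto_features_cong)
    show "length (merge_roots cs H u v) = N"
      using merge_roots_correct(1) parent uv is_parent_array_def by blast
    show "length (merge_all ops H) = N" using all(1) is_parent_array_def by blast
    show "root_of (merge_roots cs H u v) k = root_of (merge_all ops H) k" if "k < N" for k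
      using that all(2) roots0 merge_roots_correct(2) parent uv by simp
  qed
qed

end
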